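(* $$\frac{\sin(2\pi/13)\sin(3\pi/13)}{\sin(4\pi/13)\sin(6\pi/13)}-\frac{\sin(\pi/13)\sin(5\pi/13)}{\sin(2\pi/13)\sin(3\pi/13)}-\frac{\sin(4\pi/13)\sin(6\pi/13)}{\sin(5\pi/13)\sin(\pi/13)}=-4.$$ *)

theory Defs
  imports Complex_Main
begin

end

theory Submission
  imports Defs
begin

text \<open>
  Put \<open>x = 2 cos (\<pi>/13)\<close>. The relation \<open>cos (7\<pi>/13) = - cos (6\<pi>/13)\<close> makes \<open>x\<close> a root of a
  sextic with integer coefficients. The product-to-sum formulas write each of the three
  products of sines as a polynomial in \<open>x\<close>, and the claim with denominators cleared is a
  multiple of that sextic.
\<close>

text \<open>Adding the expansions of \<open>cos ((n+1)t + t)\<close> and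
  \<open>cos ((n+1)t - t)\<close> cancels the sine terms. The factor 2 makes the resulting Chebyshev
  polynomials monic with integer coefficients.\<close>

lemma two_cos_Suc_Suc:
  fixes t :: real
  shows "2 * cos (real (Suc (Suc n)) * t)
       = 2 * cos t * (2 * cos (real (Suc n) * t)) - 2 * cos (real n * t)"
proof -
  have "cos (real (Suc n) * t + t) + cos (real (Suc n) * t - t)
      = 2 * cos (real (Suc n) * t) * cos t"
    by (simp add: cos_add cos_diff)
  then show ?thesis
    by (simp add: algebra_simps)
qed

lemma two_cos_multiples:
  fixes t :: real
  defines "x \<equiv> 2 * cos t"
  shows "2 * cos (2 * t) = x^2 - 2"
    and "2 * cos (3 * t) = x^3 - 3*x"
    and "2 * cos (4 * t) = x^4 - 4*x^2 + 2"
    and "2 * cos (5 * t) = x^5 - 5*x^3 + 5*x"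
    and "2 * cos (6 * t) = x^6 - 6*x^4 + 9*x^2 - 2"
    and "2 * cos (7 * t) = x^7 - 7*x^5 + 14*x^3 - 7*x"
proof -
  show c2: "2 * cos (2 * t) = x^2 - 2"
    using two_cos_Suc_Suc[of 0 t] by (simp add: x_def power2_eq_square)
  show c3: "2 * cos (3 * t) = x^3 - 3*x"
    using two_cos_Suc_Suc[of 1 t] c2 by (simp flip: x_def) (simp add: algebra_simps power_numeral_reduce)
  show c4: "2 * cos (4 * t) = x^4 - 4*x^2 + 2"
    using two_cos_Suc_Suc[of 2 t] c2 c3 by (simp flip: x_def) (simp add: algebra_simps power_numeral_reduce)
  show c5: "2 * cos (5 * t) = x^5 - 5*x^3 + 5*x"
    using two_cos_Suc_Suc[of 3 t] c3 c4 by (simp flip: x_def) (simp add: algebra_simps power_numeral_reduce)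
  show c6: "2 * cos (6 * t) = x^6 - 6*x^4 + 9*x^2 - 2"
    using two_cos_Suc_Suc[of 4 t] c4 c5 by (simp flip: x_def) (simp add: algebra_simps power_numeral_reduce)
  show "2 * cos (7 * t) = x^7 - 7*x^5 + 14*x^3 - 7*x"
    using two_cos_Suc_Suc[of 5 t] c5 c6 by (simp flip: x_def) (simp add: algebra_simps power_numeral_reduce)
qed

lemma two_cos_pi_13_root:
  fixes x :: real
  defines "x \<equiv> 2 * cos (pi / 13)"
  shows "x^6 - x^5 - 5*x^4 + 4*x^3 + 6*x^2 - 3*x - 1 = 0"
proof -
  have "cos (7 * (pi / 13)) = - cos (6 * (pi / 13))"
    using cos_pi_minus[of "6 * (pi / 13)"] by (simp add: field_simps)
  then have "(x^7 - 7*x^5 + 14*x^3 - 7*x) + (x^6 - 6*x^4 + 9*x^2 - 2) = 0"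
    using two_cos_multiples(5,6)[of "pi / 13"] unfolding x_def by linarith
  \<comment> \<open>The angle \<pi> also satisfies \<open>cos (7t) = - cos (6t)\<close>, so the
    septic has the spurious root \<open>2 cos \<pi> = -2\<close>. Positivity of \<open>x\<close>
    rules it out.\<close>
  then have "(x + 2) * (x^6 - x^5 - 5*x^4 + 4*x^3 + 6*x^2 - 3*x - 1) = 0"
    by algebra
  moreover have "x > 0"
    unfolding x_def by (simp add: cos_gt_zero)
  ultimately show ?thesis
    by simp
qed

theorem theorem4p6:
  shows "(sin (2 * pi / 13) * sin (3 * pi / 13)) / (sin (4 * pi / 13) * sin (6 * pi / 13))
       - (sin (pi / 13) * sin (5 * pi / 13)) / (sin (2 * pi / 13) * sin (3 * pi / 13))
       - (sin (4 * pi / 13) * sin (6 * pi / 13)) / (sin (5 * pi / 13) * sin (pi / 13))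
       = (-4 :: real)"
proof -
  define t where "t = pi / 13"
  define x where "x = 2 * cos t"
  define a where "a = sin (2 * t) * sin (3 * t)"
  define b where "b = sin (4 * t) * sin (6 * t)"
  define c where "c = sin t * sin (5 * t)"
  have pos: "sin (k * t) > 0" if "0 < k" "k < 13" for k
    using that by (intro sin_gt_zero) (simp_all add: t_def field_simps)
  have "a > 0" "b > 0" "c > 0"
    using pos[of 1] by (simp_all add: a_def b_def c_def pos)
  note cos_t = two_cos_multiples[of t, folded x_def]
  have "4 * a = 2 * cos t - 2 * cos (5 * t)"
    by (simp add: a_def sin_times_sin)
  then have a: "4 * a = 5*x^3 - x^5 - 4*x"
    using cos_t by (simp add: x_def)
  \<comment> \<open>The product formula for \<open>b\<close> produces \<open>cos (10 * t)\<close>;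
    reflecting \<open>10 * t\<close> to \<pi> \<open>- 3 * t\<close> keeps \<open>b\<close> a cubic
    in \<open>x\<close>.\<close>
  have "cos (10 * t) = - cos (3 * t)"
    using cos_pi_minus[of "3 * t"] by (simp add: t_def field_simps)
  then have "4 * b = 2 * cos (2 * t) + 2 * cos (3 * t)"
    by (simp add: b_def sin_times_sin)
  then have b: "4 * b = x^3 + x^2 - 3*x - 2"
    using cos_t by simp
  have "4 * c = 2 * cos (4 * t) - 2 * cos (6 * t)"
    by (simp add: c_def sin_times_sin)
  then have c: "4 * c = 7*x^4 - x^6 - 13*x^2 + 4"
    using cos_t by simp
  have "x^6 - x^5 - 5*x^4 + 4*x^3 + 6*x^2 - 3*x - 1 = 0"
    using two_cos_pi_13_root by (simp add: x_def t_def)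
  \<comment> \<open>This is the claim multiplied by \<open>a * b * c\<close>. After substituting the
    polynomials in \<open>x\<close>, the two sides differ by a multiple of the sextic.\<close>
  with a b c have "a^2 * c - c^2 * b - b^2 * a = - 4 * a * b * c"
    by algebra
  then have "a / b - c / a - b / c = - 4"
    using \<open>a > 0\<close> \<open>b > 0\<close> \<open>c > 0\<close> by (simp add: field_simps power2_eq_square)
  then show ?thesis
    by (simp add: a_def b_def c_def t_def mult.commute)
qed

end
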